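(* Let $(A,\rightarrow,\rightsquigarrow,1)$ be a pseudo-BE algebra and $\varphi:A\to\mathbb{R}$ a map with $\varphi(1)=0$. Then $\varphi$ is a pseudo-valuation on $A$ if and only if for all $x,y,z\in A$: $(pv_4)$ $\varphi(x\rightarrow z)\le\varphi(x\rightarrow(y\rightsquigarrow z))+\varphi(y)$ and $(pv_5)$ $\varphi(x\rightsquigarrow z)\le\varphi(x\rightsquigarrow(y\rightarrow z))+\varphi(y)$.
   Context: A pseudo-BE algebra is an algebra $(A,\rightarrow,\rightsquigarrow,1)$ of type $(2,2,0)$ such that for all $x,y,z\in A$: $x\rightarrow x=x\rightsquigarrow x=1$; $x\rightarrow 1=x\rightsquigarrow 1=1$; $1\rightarrow x=1\rightsquigarrow x=x$; $x\rightarrow(y\rightsquigarrow z)=y\rightsquigarrow(x\rightarrow z)$; $x\rightarrow y=1$ iff $x\rightsquigarrow y=1$. A pseudo-valuation on $A$ is a map $\varphi:A\to\mathbb{R}$ with $\varphi(1)=0$ and $\varphi(y)-\varphi(x)\le\min\{\varphi(x\rightarrow y),\varphi(x\rightsquigarrow y)\}$ for all $x,y\in A$. *)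

theory Defs
  imports Complex_Main
begin

locale pseudo_BE_algebra =
  fixes A :: "'a set"
    and imp :: "'a \<Rightarrow> 'a \<Rightarrow> 'a" (infixr "\<rightarrow>" 60)
    and imp' :: "'a \<Rightarrow> 'a \<Rightarrow> 'a" (infixr "\<leadsto>" 60)
    and one :: 'a ("\<one>")
  assumes one_closed: "\<one> \<in> A"
    and imp_closed: "\<lbrakk>x \<in> A; y \<in> A\<rbrakk> \<Longrightarrow> x \<rightarrow> y \<in> A"
    and imp'_closed: "\<lbrakk>x \<in> A; y \<in> A\<rbrakk> \<Longrightarrow> x \<leadsto> y \<in> A"
    and imp_refl: "x \<in> A \<Longrightarrow> x \<rightarrow> x = \<one>"
    and imp'_refl: "x \<in> A \<Longrightarrow> x \<leadsto> x = \<one>"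
    and imp_one: "x \<in> A \<Longrightarrow> x \<rightarrow> \<one> = \<one>"
    and imp'_one: "x \<in> A \<Longrightarrow> x \<leadsto> \<one> = \<one>"
    and one_imp: "x \<in> A \<Longrightarrow> \<one> \<rightarrow> x = x"
    and one_imp': "x \<in> A \<Longrightarrow> \<one> \<leadsto> x = x"
    and exchange: "\<lbrakk>x \<in> A; y \<in> A; z \<in> A\<rbrakk> \<Longrightarrow> x \<rightarrow> (y \<leadsto> z) = y \<leadsto> (x \<rightarrow> z)"
    and imp_eq_one_iff: "\<lbrakk>x \<in> A; y \<in> A\<rbrakk> \<Longrightarrow> x \<rightarrow> y = \<one> \<longleftrightarrow> x \<leadsto> y = \<one>"

text \<open>A map from \<open>A\<close> to the reals is represented by a total function on the ambient type;
  only its values on \<open>A\<close> are constrained.\<close>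

definition pseudo_valuation ::
  "'a set \<Rightarrow> ('a \<Rightarrow> 'a \<Rightarrow> 'a) \<Rightarrow> ('a \<Rightarrow> 'a \<Rightarrow> 'a) \<Rightarrow> 'a \<Rightarrow> ('a \<Rightarrow> real) \<Rightarrow> bool" where
  "pseudo_valuation A imp imp' one \<phi> \<longleftrightarrow>
     \<phi> one = 0 \<and> (\<forall>x\<in>A. \<forall>y\<in>A. \<phi> y - \<phi> x \<le> min (\<phi> (imp x y)) (\<phi> (imp' x y)))"

end

theory Submission imports Defs begin

text \<open>Exchange moves the premise \<open>y\<close> to the front:
  \<open>x \<rightarrow> (y \<leadsto> z)\<close> equals
  \<open>y \<leadsto> (x \<rightarrow> z)\<close>, so each inequality on the right is a valuation
  inequality from \<open>y\<close> to an implication. Conversely, a leading \<open>\<one>\<close>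
  can be erased from both arrows, which turns the two inequalities back into the two bounds of a
  pseudo-valuation.\<close>

theorem theorem6p3:
  fixes A :: "'a set"
    and imp :: "'a \<Rightarrow> 'a \<Rightarrow> 'a" (infixr "\<rightarrow>" 60)
    and imp' :: "'a \<Rightarrow> 'a \<Rightarrow> 'a" (infixr "\<leadsto>" 60)
    and one :: 'a ("\<one>")
    and \<phi> :: "'a \<Rightarrow> real"
  assumes "pseudo_BE_algebra A (\<rightarrow>) (\<leadsto>) \<one>"
    and "\<phi> \<one> = 0"
  shows "pseudo_valuation A (\<rightarrow>) (\<leadsto>) \<one> \<phi> \<longleftrightarrow>
    (\<forall>x\<in>A. \<forall>y\<in>A. \<forall>z\<in>A.
       \<phi> (x \<rightarrow> z) \<le> \<phi> (x \<rightarrow> (y \<leadsto> z)) + \<phi> y \<and>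
       \<phi> (x \<leadsto> z) \<le> \<phi> (x \<leadsto> (y \<rightarrow> z)) + \<phi> y)"
proof -
  interpret pseudo_BE_algebra A "(\<rightarrow>)" "(\<leadsto>)" \<one> by fact
  show ?thesis (is "?L \<longleftrightarrow> ?R")
  proof
    assume ?L
    then have pv: "\<phi> v - \<phi> u \<le> \<phi> (u \<rightarrow> v)" "\<phi> v - \<phi> u \<le> \<phi> (u \<leadsto> v)"
      if "u \<in> A" "v \<in> A" for u v
      using that by (auto simp: pseudo_valuation_def)
    show ?R
    proof (intro ballI conjI)
      fix x y z assume A: "x \<in> A" "y \<in> A" "z \<in> A"
      \<comment> \<open>The arrows cross: the bound for \<open>\<leadsto>\<close> gives the
        inequality about \<open>x \<rightarrow> z\<close>, since exchange swaps the outer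
        arrow.\<close>
      show "\<phi> (x \<rightarrow> z) \<le> \<phi> (x \<rightarrow> (y \<leadsto> z)) + \<phi> y"
        using pv(2)[of y "x \<rightarrow> z"] A by (simp add: exchange imp_closed)
      show "\<phi> (x \<leadsto> z) \<le> \<phi> (x \<leadsto> (y \<rightarrow> z)) + \<phi> y"
        using pv(1)[of y "x \<leadsto> z"] A by (simp add: exchange imp'_closed)
    qed
  next
    assume R: ?R
    have "\<phi> y - \<phi> x \<le> min (\<phi> (x \<rightarrow> y)) (\<phi> (x \<leadsto> y))" if A: "x \<in> A" "y \<in> A" for x y
      \<comment> \<open>Instance with \<open>\<one>\<close>, \<open>x\<close>, \<open>y\<close> in
        place of \<open>x\<close>, \<open>y\<close>, \<open>z\<close>: the first inequality bounds
        by \<open>x \<leadsto> y\<close>, the second by \<open>x \<rightarrow> y\<close>.\<close>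
      using R[rule_format, OF one_closed A] A
      by (simp add: one_imp one_imp' imp_closed imp'_closed)
    then show ?L using assms(2) by (simp add: pseudo_valuation_def)
  qed
qed

end
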